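(* $\mathbf{MS4_S}[n]$ has the finite model property.
   Context: An $\mathsf{MS4}$-algebra is a tuple $(B,\lozenge,\exists)$ where $B$ is a Boolean algebra, $\lozenge$ is an $\mathsf{S4}$ (closure) operator, $\exists$ is an $\mathsf{S5}$ operator, and $\exists\lozenge a\le\lozenge\exists a$; $\mathbf{MS4}$ is the variety of these algebras. Write $\square=\neg\lozenge\neg$, $\forall=\neg\exists\neg$. Let $P_1=\lozenge\square q_1\to\square q_1$ and $P_n=\lozenge(\square q_n\wedge\neg P_{n-1})\to\square q_n$; for a variety $\mathbf{V}$, $\mathbf{V}[n]=\mathbf{V}+P_n$ (algebras of depth $\le n$). Let $P^0_n$ be $P_n$ with every $\lozenge$ replaced by $\lozenge\exists$ (and correspondingly $\square$ by $\square\forall$). $\mathbf{MS4_S}=\mathbf{MS4}+P^0_1$ (the largest semisimple subvariety of $\mathbf{MS4}$), so $\mathbf{MS4_S}[n]=\mathbf{MS4}+P^0_1+P_n$. *)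

theory Defs
  imports Main
begin

record 'a ba =
  carrier :: "'a set"
  meet :: "'a \<Rightarrow> 'a \<Rightarrow> 'a"
  join :: "'a \<Rightarrow> 'a \<Rightarrow> 'a"
  neg :: "'a \<Rightarrow> 'a"
  bot :: "'a"
  top :: "'a"

record 'a ms4 = "'a ba" +
  dia :: "'a \<Rightarrow> 'a"
  ex :: "'a \<Rightarrow> 'a"

hide_const (open) bot top

definition leq :: "('a, 'm) ba_scheme \<Rightarrow> 'a \<Rightarrow> 'a \<Rightarrow> bool" where
  "leq B x y \<longleftrightarrow> meet B x y = x"

text \<open>The axioms are those of the library locale \<open>abstract_boolean_algebra\<close>, relativised to a
  carrier so that finite algebras and algebras on arbitrary types can be treated uniformly.
  The one-element algebra is allowed, as it is a member of every variety.\<close>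

locale boolean_alg =
  fixes B :: "('a, 'm) ba_scheme"
  assumes meet_closed: "\<lbrakk>x \<in> carrier B; y \<in> carrier B\<rbrakk> \<Longrightarrow> meet B x y \<in> carrier B"
    and join_closed: "\<lbrakk>x \<in> carrier B; y \<in> carrier B\<rbrakk> \<Longrightarrow> join B x y \<in> carrier B"
    and neg_closed: "x \<in> carrier B \<Longrightarrow> neg B x \<in> carrier B"
    and bot_closed: "ba.bot B \<in> carrier B"
    and top_closed: "ba.top B \<in> carrier B"
    and meet_assoc: "\<lbrakk>x \<in> carrier B; y \<in> carrier B; z \<in> carrier B\<rbrakk>
      \<Longrightarrow> meet B (meet B x y) z = meet B x (meet B y z)"
    and join_assoc: "\<lbrakk>x \<in> carrier B; y \<in> carrier B; z \<in> carrier B\<rbrakk>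
      \<Longrightarrow> join B (join B x y) z = join B x (join B y z)"
    and meet_comm: "\<lbrakk>x \<in> carrier B; y \<in> carrier B\<rbrakk> \<Longrightarrow> meet B x y = meet B y x"
    and join_comm: "\<lbrakk>x \<in> carrier B; y \<in> carrier B\<rbrakk> \<Longrightarrow> join B x y = join B y x"
    and meet_join_distrib: "\<lbrakk>x \<in> carrier B; y \<in> carrier B; z \<in> carrier B\<rbrakk>
      \<Longrightarrow> meet B x (join B y z) = join B (meet B x y) (meet B x z)"
    and join_meet_distrib: "\<lbrakk>x \<in> carrier B; y \<in> carrier B; z \<in> carrier B\<rbrakk>
      \<Longrightarrow> join B x (meet B y z) = meet B (join B x y) (join B x z)"
    and meet_top: "x \<in> carrier B \<Longrightarrow> meet B x (ba.top B) = x"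
    and join_bot: "x \<in> carrier B \<Longrightarrow> join B x (ba.bot B) = x"
    and meet_neg: "x \<in> carrier B \<Longrightarrow> meet B x (neg B x) = ba.bot B"
    and join_neg: "x \<in> carrier B \<Longrightarrow> join B x (neg B x) = ba.top B"

locale s4_operator = boolean_alg B for B :: "('a, 'm) ba_scheme" +
  fixes f :: "'a \<Rightarrow> 'a"
  assumes op_closed: "x \<in> carrier B \<Longrightarrow> f x \<in> carrier B"
    and op_bot: "f (ba.bot B) = ba.bot B"
    and op_join: "\<lbrakk>x \<in> carrier B; y \<in> carrier B\<rbrakk> \<Longrightarrow> f (join B x y) = join B (f x) (f y)"
    and op_extensive: "x \<in> carrier B \<Longrightarrow> leq B x (f x)"
    and op_transitive: "x \<in> carrier B \<Longrightarrow> leq B (f (f x)) (f x)"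

locale s5_operator = s4_operator B f for B :: "('a, 'm) ba_scheme" and f +
  assumes op_symmetric: "x \<in> carrier B \<Longrightarrow> leq B (f x) (neg B (f (neg B (f x))))"

locale ms4_algebra =
  fixes B :: "'a ms4"
  assumes dia_s4: "s4_operator B (dia B)"
    and ex_s5: "s5_operator B (ex B)"
    and ex_dia_le: "x \<in> carrier B \<Longrightarrow> leq B (ex B (dia B x)) (dia B (ex B x))"

datatype fm =
    Var nat
  | Bot
  | Top
  | Neg fm
  | And fm fm
  | Or fm fm
  | Dia fm
  | Ex fm

definition Imp :: "fm \<Rightarrow> fm \<Rightarrow> fm" where
  "Imp p q = Or (Neg p) q"

definition Box :: "fm \<Rightarrow> fm" where
  "Box p = Neg (Dia (Neg p))"

definition All :: "fm \<Rightarrow> fm" where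
  "All p = Neg (Ex (Neg p))"

hide_const (open) Ex All

primrec sem :: "'a ms4 \<Rightarrow> (nat \<Rightarrow> 'a) \<Rightarrow> fm \<Rightarrow> 'a" where
  "sem B v (Var i) = v i"
| "sem B v Bot = ba.bot B"
| "sem B v Top = ba.top B"
| "sem B v (Neg p) = neg B (sem B v p)"
| "sem B v (And p q) = meet B (sem B v p) (sem B v q)"
| "sem B v (Or p q) = join B (sem B v p) (sem B v q)"
| "sem B v (Dia p) = dia B (sem B v p)"
| "sem B v (fm.Ex p) = ex B (sem B v p)"

definition sat_eq :: "'a ms4 \<Rightarrow> fm \<Rightarrow> fm \<Rightarrow> bool" where
  "sat_eq B s t \<longleftrightarrow> (\<forall>v. (\<forall>i. v i \<in> carrier B) \<longrightarrow> sem B v s = sem B v t)"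

definition valid :: "'a ms4 \<Rightarrow> fm \<Rightarrow> bool" where
  "valid B p \<longleftrightarrow> sat_eq B p Top"

text \<open>Depth formulas, parametrised by the possibility operator \<open>d\<close> and the necessity operator
  \<open>b\<close>. Only indices at least 1 are meaningful; the value at 0 is a dummy.\<close>

fun depth_fm :: "(fm \<Rightarrow> fm) \<Rightarrow> (fm \<Rightarrow> fm) \<Rightarrow> nat \<Rightarrow> fm" where
  "depth_fm d b 0 = Bot"
| "depth_fm d b (Suc 0) = Imp (d (b (Var 1))) (b (Var 1))"
| "depth_fm d b (Suc (Suc n)) =
    Imp (d (And (b (Var (Suc (Suc n)))) (Neg (depth_fm d b (Suc n))))) (b (Var (Suc (Suc n))))"

definition P :: "nat \<Rightarrow> fm" where
  "P n = depth_fm Dia Box n"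

definition P0 :: "nat \<Rightarrow> fm" where
  "P0 n = depth_fm (\<lambda>p. Dia (fm.Ex p)) (\<lambda>p. Box (Defs.All p)) n"

text \<open>A subvariety of the variety of all MS4-algebras is given by a set \<open>\<Gamma>\<close> of formulas.\<close>

definition in_variety :: "fm set \<Rightarrow> 'a ms4 \<Rightarrow> bool" where
  "in_variety \<Gamma> B \<longleftrightarrow> ms4_algebra B \<and> (\<forall>p\<in>\<Gamma>. valid B p)"

definition MS4S :: "nat \<Rightarrow> fm set" where
  "MS4S n = {P0 1, P n}"

text \<open>Finite model property: every equation refuted in some member of the variety is refuted in
  some finite member. HOL cannot quantify over types inside a formula, so the type on which
  the arbitrary members live is a parameter; a statement for all type variables \<open>'a\<close> covers
  every algebra. For the finite members the type \<open>nat\<close> suffices, because every finite algebra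
  is isomorphic to one whose carrier is a set of natural numbers.\<close>

definition has_fmp :: "'a itself \<Rightarrow> fm set \<Rightarrow> bool" where
  "has_fmp (_ :: 'a itself) \<Gamma> \<longleftrightarrow>
    (\<forall>s t. (\<exists>A :: 'a ms4. in_variety \<Gamma> A \<and> \<not> sat_eq A s t) \<longrightarrow>
      (\<exists>F :: nat ms4. finite (carrier F) \<and> in_variety \<Gamma> F \<and> \<not> sat_eq F s t))"

end

theory Submission
  imports Defs "HOL-Library.Nat_Bijection"
begin

text \<open>In the ultrafilter frame of an algebra satisfying the formula for depth 1 of \<open>\<diamond>\<exists>\<close>, the canonical
  relation of \<open>\<diamond>\<exists>\<close> is an equivalence relation, equal to the composite of the canonical relations
  \<open>R\<close> of \<open>\<diamond>\<close> and \<open>E\<close> of \<open>\<exists>\<close>. On one of its classes the composite is the total relation. As \<open>R\<close> has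
  finite depth, colouring a point by the subformulas true at it, the subformulas realised in its
  cluster and, recursively, the colours strictly above it gives a bisimulation for \<open>R\<close> with
  finitely many classes. On the quotient, \<open>E\<close> may be replaced by the coarser relation of satisfying the
  same subformulas that begin with \<open>\<exists>\<close>: enlarging \<open>E\<close> keeps the composite total, so all axioms
  survive.\<close>

section \<open>Ultrafilters of a Boolean algebra\<close>

context boolean_alg
begin

abbreviation meetB (infixl "\<sqinter>" 70) where "x \<sqinter> y \<equiv> meet B x y"
abbreviation joinB (infixl "\<squnion>" 65) where "x \<squnion> y \<equiv> join B x y"
abbreviation leqB (infix "\<sqsubseteq>" 50) where "x \<sqsubseteq> y \<equiv> leq B x y"

lemmas closed = meet_closed join_closed neg_closed bot_closed top_closed

section \<open>Lattice laws and the order\<close>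

lemma meet_idem: "x \<in> carrier B \<Longrightarrow> x \<sqinter> x = x"
  by (metis closed join_neg join_bot meet_join_distrib meet_neg meet_top)

lemma join_idem: "x \<in> carrier B \<Longrightarrow> x \<squnion> x = x"
  by (metis closed join_neg join_bot join_meet_distrib meet_neg meet_top)

lemma meet_bot: "x \<in> carrier B \<Longrightarrow> x \<sqinter> ba.bot B = ba.bot B"
  by (metis closed meet_assoc meet_idem meet_neg)

lemma join_top: "x \<in> carrier B \<Longrightarrow> x \<squnion> ba.top B = ba.top B"
  by (metis closed join_assoc join_idem join_neg)

lemma absorb_meet: "\<lbrakk>x \<in> carrier B; y \<in> carrier B\<rbrakk> \<Longrightarrow> x \<squnion> x \<sqinter> y = x"
  by (metis closed join_comm join_top meet_join_distrib meet_top)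

lemma absorb_join: "\<lbrakk>x \<in> carrier B; y \<in> carrier B\<rbrakk> \<Longrightarrow> x \<sqinter> (x \<squnion> y) = x"
  by (metis absorb_meet closed join_meet_distrib meet_idem join_idem meet_join_distrib)

lemma leq_refl: "x \<in> carrier B \<Longrightarrow> x \<sqsubseteq> x"
  by (simp add: leq_def meet_idem)

lemma leq_trans:
  "\<lbrakk>x \<sqsubseteq> y; y \<sqsubseteq> z; x \<in> carrier B; y \<in> carrier B; z \<in> carrier B\<rbrakk> \<Longrightarrow> x \<sqsubseteq> z"
  unfolding leq_def by (metis meet_assoc)

lemma leq_antisym: "\<lbrakk>x \<sqsubseteq> y; y \<sqsubseteq> x; x \<in> carrier B; y \<in> carrier B\<rbrakk> \<Longrightarrow> x = y"
  unfolding leq_def by (metis meet_comm)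

lemma leq_iff_join: "\<lbrakk>x \<in> carrier B; y \<in> carrier B\<rbrakk> \<Longrightarrow> x \<sqsubseteq> y \<longleftrightarrow> x \<squnion> y = y"
  unfolding leq_def by (metis absorb_join absorb_meet join_comm meet_comm)

lemma meet_leq1: "\<lbrakk>x \<in> carrier B; y \<in> carrier B\<rbrakk> \<Longrightarrow> x \<sqinter> y \<sqsubseteq> x"
  unfolding leq_def by (metis closed meet_assoc meet_comm meet_idem)

lemma meet_leq2: "\<lbrakk>x \<in> carrier B; y \<in> carrier B\<rbrakk> \<Longrightarrow> x \<sqinter> y \<sqsubseteq> y"
  by (metis meet_comm meet_leq1)

lemma leq_meet:
  "\<lbrakk>z \<sqsubseteq> x; z \<sqsubseteq> y; x \<in> carrier B; y \<in> carrier B; z \<in> carrier B\<rbrakk> \<Longrightarrow> z \<sqsubseteq> x \<sqinter> y"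
  unfolding leq_def by (metis meet_assoc)

lemma leq_join1: "\<lbrakk>x \<in> carrier B; y \<in> carrier B\<rbrakk> \<Longrightarrow> x \<sqsubseteq> x \<squnion> y"
  by (simp add: leq_def absorb_join)

lemma leq_join2: "\<lbrakk>x \<in> carrier B; y \<in> carrier B\<rbrakk> \<Longrightarrow> y \<sqsubseteq> x \<squnion> y"
  by (metis join_comm leq_join1)

lemma join_leq:
  "\<lbrakk>x \<sqsubseteq> z; y \<sqsubseteq> z; x \<in> carrier B; y \<in> carrier B; z \<in> carrier B\<rbrakk> \<Longrightarrow> x \<squnion> y \<sqsubseteq> z"
  by (simp add: leq_iff_join closed join_assoc)

lemma leq_top: "x \<in> carrier B \<Longrightarrow> x \<sqsubseteq> ba.top B"
  by (simp add: leq_def meet_top)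

lemma bot_leq: "x \<in> carrier B \<Longrightarrow> ba.bot B \<sqsubseteq> x"
  by (metis leq_def closed meet_bot meet_comm)

lemma meet_mono:
  assumes "a \<sqsubseteq> c" "b \<sqsubseteq> d" "a \<in> carrier B" "b \<in> carrier B" "c \<in> carrier B" "d \<in> carrier B"
  shows "a \<sqinter> b \<sqsubseteq> c \<sqinter> d"
  by (meson assms closed leq_meet leq_trans meet_leq1 meet_leq2)

section \<open>Filters, ideals and the extension to ultrafilters\<close>

definition filt :: "'a set \<Rightarrow> bool" where
  "filt F \<longleftrightarrow> F \<subseteq> carrier B \<and> ba.top B \<in> F \<and> (\<forall>x\<in>F. \<forall>y\<in>F. x \<sqinter> y \<in> F)
    \<and> (\<forall>x\<in>F. \<forall>y\<in>carrier B. x \<sqsubseteq> y \<longrightarrow> y \<in> F)"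

definition ideal :: "'a set \<Rightarrow> bool" where
  "ideal I \<longleftrightarrow> I \<subseteq> carrier B \<and> ba.bot B \<in> I \<and> (\<forall>x\<in>I. \<forall>y\<in>I. x \<squnion> y \<in> I)
    \<and> (\<forall>x\<in>I. \<forall>y\<in>carrier B. y \<sqsubseteq> x \<longrightarrow> y \<in> I)"

definition ultra :: "'a set \<Rightarrow> bool" where
  "ultra U \<longleftrightarrow> filt U \<and> (\<forall>x\<in>carrier B. neg B x \<in> U \<longleftrightarrow> x \<notin> U)"

text \<open>\<open>G\<close> is the filter generated by \<open>F\<close> and \<open>c\<close>,
  against which maximality is tested in the Zorn argument below.\<close>

lemma filt_extend:
  assumes F: "filt F" and c: "c \<in> carrier B"
  defines "G \<equiv> {y \<in> carrier B. \<exists>u\<in>F. u \<sqinter> c \<sqsubseteq> y}"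
  shows "filt G" "F \<subseteq> G" "c \<in> G"
proof -
  have FB: "F \<subseteq> carrier B" and tF: "ba.top B \<in> F" using F by (auto simp: filt_def)
  show "F \<subseteq> G" unfolding G_def using FB c by (auto intro: meet_leq1)
  then have "ba.top B \<in> G" using tF by blast
  moreover have "x \<sqinter> y \<in> G" if "x \<in> G" "y \<in> G" for x y
  proof -
    from that obtain u w where uw: "u \<in> F" "w \<in> F" "u \<sqinter> c \<sqsubseteq> x" "w \<sqinter> c \<sqsubseteq> y"
      and xy: "x \<in> carrier B" "y \<in> carrier B" unfolding G_def by auto
    have m: "u \<sqinter> w \<in> F" using F uw unfolding filt_def by blast
    have uwB: "u \<in> carrier B" "w \<in> carrier B" using uw FB by auto
    have "(u \<sqinter> w) \<sqinter> c \<sqsubseteq> u \<sqinter> c" "(u \<sqinter> w) \<sqinter> c \<sqsubseteq> w \<sqinter> c"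
      using uwB c by (auto intro!: meet_mono closed meet_leq1 meet_leq2 leq_refl)
    then have "(u \<sqinter> w) \<sqinter> c \<sqsubseteq> x \<sqinter> y"
      by (meson uwB uw xy c closed leq_meet leq_trans)
    then show ?thesis unfolding G_def using m xy by (auto intro: closed)
  qed
  moreover have "y \<in> G" if "x \<in> G" "y \<in> carrier B" "x \<sqsubseteq> y" for x y
    using that FB c unfolding G_def by (auto; meson closed leq_trans subsetD)
  ultimately show "filt G" unfolding filt_def by (auto simp: G_def)
  show "c \<in> G" unfolding G_def using c tF
    by (auto intro: meet_leq2 closed)
qed

text \<open>Zorn's lemma gives a filter \<open>U\<close> maximal among those that contain
  \<open>F\<close> and avoid \<open>I\<close>. If both \<open>x\<close> and its complement were
  missing from \<open>U\<close>, adjoining either one would run into \<open>I\<close>, and an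
  element of \<open>U\<close> split along \<open>x\<close> would then lie in
  \<open>I\<close>.\<close>

theorem ultra_extension:
  assumes F: "filt F" and I: "ideal I" and disj: "F \<inter> I = {}"
  obtains U where "ultra U" "F \<subseteq> U" "U \<inter> I = {}"
proof -
  let ?S = "{G. filt G \<and> F \<subseteq> G \<and> G \<inter> I = {}}"
  have "\<exists>U\<in>?S. \<forall>X\<in>?S. U \<subseteq> X \<longrightarrow> X = U"
  proof (rule subset_Zorn_nonempty)
    show "?S \<noteq> {}" using F disj by blast
    fix C assume "C \<noteq> {}" and C: "subset.chain ?S C"
    then have CS: "\<And>G. G \<in> C \<Longrightarrow> filt G \<and> F \<subseteq> G \<and> G \<inter> I = {}"
      unfolding subset.chain_def by auto
    have "x \<sqinter> y \<in> \<Union>C" if xy: "x \<in> \<Union>C" "y \<in> \<Union>C" for x y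
    proof -
      from xy obtain G H where GH: "G \<in> C" "x \<in> G" "H \<in> C" "y \<in> H" by auto
      have "G \<subseteq> H \<or> H \<subseteq> G"
        using C GH(1,3) by (auto dest: subset.chain_total)
      then obtain K where "K \<in> C" "x \<in> K" "y \<in> K" using GH by blast
      moreover from this have "filt K" using CS by blast
      ultimately have "x \<sqinter> y \<in> K" unfolding filt_def by blast
      then show ?thesis using \<open>K \<in> C\<close> by blast
    qed
    moreover obtain G where "G \<in> C" using \<open>C \<noteq> {}\<close> by auto
    moreover from this CS have "ba.top B \<in> \<Union>C" unfolding filt_def by blast
    moreover have "\<Union>C \<subseteq> carrier B" using CS unfolding filt_def by blast
    moreover have "y \<in> \<Union>C" if "x \<in> \<Union>C" "y \<in> carrier B" "x \<sqsubseteq> y" for x y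
      using that CS unfolding filt_def by (meson UnionE UnionI)
    ultimately have "filt (\<Union>C)" unfolding filt_def by blast
    then show "\<Union>C \<in> ?S" using CS \<open>G \<in> C\<close> by blast
  qed
  then obtain U where U: "filt U" "F \<subseteq> U" "U \<inter> I = {}"
    and max: "\<And>X. \<lbrakk>filt X; F \<subseteq> X; X \<inter> I = {}; U \<subseteq> X\<rbrakk> \<Longrightarrow> X = U" by auto
  have UB: "U \<subseteq> carrier B" using U by (auto simp: filt_def)
  \<comment> \<open>By maximality the filter generated by \<open>U\<close> and \<open>c\<close>
    meets \<open>I\<close>; as \<open>I\<close> is closed downwards, it then contains some
    \<open>u \<sqinter> c\<close> itself.\<close>
  have hit: "\<exists>u\<in>U. u \<sqinter> c \<in> I" if c: "c \<in> carrier B" "c \<notin> U" for c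
  proof (rule ccontr)
    assume n: "\<not> ?thesis"
    let ?G = "{y \<in> carrier B. \<exists>u\<in>U. u \<sqinter> c \<sqsubseteq> y}"
    have "y \<notin> I" if "u \<in> U" "u \<sqinter> c \<sqsubseteq> y" for u y
    proof
      assume "y \<in> I"
      moreover have "u \<sqinter> c \<in> carrier B" using that UB c meet_closed by blast
      ultimately have "u \<sqinter> c \<in> I" using I that unfolding ideal_def by blast
      then show False using n that by blast
    qed
    then have "?G \<inter> I = {}" by blast
    then have "?G = U" using filt_extend[OF U(1) c(1)] max U(2) by blast
    then show False using filt_extend(3)[OF U(1) c(1)] c(2) by blast
  qed
  have "neg B x \<in> U \<longleftrightarrow> x \<notin> U" if x: "x \<in> carrier B" for x
  proof
    assume nx: "neg B x \<in> U"
    show "x \<notin> U"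
    proof
      assume "x \<in> U"
      then have "ba.bot B \<in> U" using nx U(1) meet_neg[OF x] unfolding filt_def by metis
      then show False using U(3) I unfolding ideal_def by blast
    qed
  next
    assume "x \<notin> U"
    then obtain u where u: "u \<in> U" "u \<sqinter> x \<in> I" using hit x by blast
    show "neg B x \<in> U"
    proof (rule ccontr)
      assume "neg B x \<notin> U"
      then obtain w where w: "w \<in> U" "w \<sqinter> neg B x \<in> I" using hit neg_closed[OF x] by blast
      have uwB: "u \<in> carrier B" "w \<in> carrier B" using u w UB by auto
      let ?m = "u \<sqinter> w"
      have m: "?m \<in> carrier B" using uwB closed by auto
      \<comment> \<open>Split along \<open>x\<close>, the element \<open>?m\<close> of
        \<open>U\<close> is bounded by a join of two elements of \<open>I\<close>.\<close>
      have "?m = ?m \<sqinter> x \<squnion> ?m \<sqinter> neg B x"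
        by (metis m x closed join_neg meet_join_distrib meet_top)
      also have "\<dots> \<sqsubseteq> u \<sqinter> x \<squnion> w \<sqinter> neg B x"
      proof (rule join_leq)
        have "?m \<sqinter> x \<sqsubseteq> u \<sqinter> x" "?m \<sqinter> neg B x \<sqsubseteq> w \<sqinter> neg B x"
          using uwB x by (auto intro!: meet_mono closed meet_leq1 meet_leq2 leq_refl)
        then show "?m \<sqinter> x \<sqsubseteq> u \<sqinter> x \<squnion> w \<sqinter> neg B x"
          "?m \<sqinter> neg B x \<sqsubseteq> u \<sqinter> x \<squnion> w \<sqinter> neg B x"
          by (meson uwB x m closed leq_join1 leq_join2 leq_trans)+
      qed (use uwB x closed in auto)
      finally have "?m \<in> I"
        using u w m I unfolding ideal_def by blast
      moreover have "?m \<in> U" using u w U(1) unfolding filt_def by blast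
      ultimately show False using U(3) by blast
    qed
  qed
  then have "ultra U" using U(1) by (simp add: ultra_def)
  then show thesis using that U by blast
qed

lemma filt_principal:
  assumes a: "a \<in> carrier B"
  shows "filt {z \<in> carrier B. a \<sqsubseteq> z}"
  unfolding filt_def
proof (intro conjI ballI impI)
  fix x y assume "x \<in> {z \<in> carrier B. a \<sqsubseteq> z}" "y \<in> carrier B" "x \<sqsubseteq> y"
  then show "y \<in> {z \<in> carrier B. a \<sqsubseteq> z}" using leq_trans[OF _ _ a] by blast
qed (use a in \<open>auto simp: leq_top leq_meet closed\<close>)

lemma ideal_principal:
  assumes a: "a \<in> carrier B"
  shows "ideal {z \<in> carrier B. z \<sqsubseteq> a}"
  unfolding ideal_def
proof (intro conjI ballI impI)
  fix x y assume "x \<in> {z \<in> carrier B. z \<sqsubseteq> a}" "y \<in> carrier B" "y \<sqsubseteq> x"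
  then show "y \<in> {z \<in> carrier B. z \<sqsubseteq> a}" using leq_trans[OF _ _ _ _ a] by blast
qed (use a in \<open>auto simp: bot_leq join_leq closed\<close>)

section \<open>Ultrafilters as truth assignments; separation of elements\<close>

lemma ultra_carrier: "\<lbrakk>ultra U; x \<in> U\<rbrakk> \<Longrightarrow> x \<in> carrier B"
  unfolding ultra_def filt_def by blast

lemma ultra_mono: "\<lbrakk>ultra U; x \<in> U; x \<sqsubseteq> y; y \<in> carrier B\<rbrakk> \<Longrightarrow> y \<in> U"
  unfolding ultra_def filt_def by blast

lemma ultra_neg: "\<lbrakk>ultra U; x \<in> carrier B\<rbrakk> \<Longrightarrow> neg B x \<in> U \<longleftrightarrow> x \<notin> U"
  by (simp add: ultra_def)

lemma ultra_top: "ultra U \<Longrightarrow> ba.top B \<in> U"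
  by (simp add: ultra_def filt_def)

lemma ultra_bot: "ultra U \<Longrightarrow> ba.bot B \<notin> U"
  by (metis closed meet_neg meet_top meet_comm ultra_neg ultra_top)

lemma ultra_meet:
  assumes U: "ultra U" and x: "x \<in> carrier B" and y: "y \<in> carrier B"
  shows "x \<sqinter> y \<in> U \<longleftrightarrow> x \<in> U \<and> y \<in> U"
  using assms ultra_mono[OF U _ meet_leq1[OF x y]] ultra_mono[OF U _ meet_leq2[OF x y]]
  unfolding ultra_def filt_def by blast

lemma ultra_join:
  assumes U: "ultra U" and x: "x \<in> carrier B" and y: "y \<in> carrier B"
  shows "x \<squnion> y \<in> U \<longleftrightarrow> x \<in> U \<or> y \<in> U"
proof
  assume xy: "x \<squnion> y \<in> U"
  show "x \<in> U \<or> y \<in> U"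
  proof (rule ccontr)
    assume "\<not> ?thesis"
    then have "neg B x \<in> U" "neg B y \<in> U" using assms ultra_neg by auto
    then have "neg B y \<sqinter> (neg B x \<sqinter> (x \<squnion> y)) \<in> U"
      using xy assms by (simp add: ultra_meet closed)
    moreover have "neg B y \<sqinter> (neg B x \<sqinter> (x \<squnion> y)) = ba.bot B"
    proof -
      have "neg B x \<sqinter> (x \<squnion> y) = ba.bot B \<squnion> neg B x \<sqinter> y"
        using x y by (metis closed meet_join_distrib meet_neg meet_comm)
      also have "\<dots> = neg B x \<sqinter> y" using x y by (metis closed join_bot join_comm)
      finally show ?thesis using x y
        by (metis closed meet_assoc meet_bot meet_comm meet_neg)
    qed
    ultimately show False using ultra_bot[OF U] by simp
  qed
qed (use ultra_mono[OF U _ leq_join1[OF x y]] ultra_mono[OF U _ leq_join2[OF x y]] join_closed[OF x y] in blast)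

text \<open>Otherwise the principal filter of \<open>x\<close> misses the principal ideal of
  \<open>y\<close>, and an ultrafilter separating the two contains \<open>x\<close> but not
  \<open>y\<close>.\<close>

lemma leq_if_ultra:
  assumes x: "x \<in> carrier B" and y: "y \<in> carrier B"
    and *: "\<And>U. \<lbrakk>ultra U; x \<in> U\<rbrakk> \<Longrightarrow> y \<in> U"
  shows "x \<sqsubseteq> y"
proof (rule ccontr)
  assume n: "\<not> x \<sqsubseteq> y"
  let ?F = "{z \<in> carrier B. x \<sqsubseteq> z}" and ?I = "{z \<in> carrier B. z \<sqsubseteq> y}"
  have "filt ?F" by (rule filt_principal[OF x])
  moreover have "ideal ?I" by (rule ideal_principal[OF y])
  moreover have "?F \<inter> ?I = {}" using n leq_trans[OF _ _ x _ y] by blast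
  ultimately obtain U where "ultra U" "?F \<subseteq> U" "U \<inter> ?I = {}" by (rule ultra_extension)
  then show False using *[of U] x y leq_refl by blast
qed

lemma eq_if_ultra:
  assumes "x \<in> carrier B" "y \<in> carrier B" "\<And>U. ultra U \<Longrightarrow> x \<in> U \<longleftrightarrow> y \<in> U"
  shows "x = y"
  using assms by (intro leq_antisym leq_if_ultra) auto

lemma neg_neg: "x \<in> carrier B \<Longrightarrow> neg B (neg B x) = x"
  by (rule eq_if_ultra) (auto simp: ultra_neg closed)

end

section \<open>Canonical relations\<close>

text \<open>Between ultrafilters this is equivalent to the usual condition that
  \<open>neg B (f (neg B a)) \<in> x\<close> implies \<open>a \<in> y\<close> for \<open>a\<close>
  in the carrier. In this form successors can be built by avoiding an ideal.\<close>

definition crel :: "('a \<Rightarrow> 'a) \<Rightarrow> 'a set \<Rightarrow> 'a set \<Rightarrow> bool" where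
  "crel f x y \<longleftrightarrow> (\<forall>a\<in>y. f a \<in> x)"

context s4_operator
begin

lemma op_mono: "\<lbrakk>x \<sqsubseteq> y; x \<in> carrier B; y \<in> carrier B\<rbrakk> \<Longrightarrow> f x \<sqsubseteq> f y"
  by (metis leq_iff_join op_closed op_join)

text \<open>An ultrafilter \<open>y\<close> satisfies \<open>crel f x y\<close> exactly when it
  avoids this set, so \<open>ultra_extension\<close> can produce successors. Closure under joins
  combines additivity of \<open>f\<close> with primeness of \<open>x\<close>.\<close>

lemma ideal_preimage:
  assumes x: "ultra x"
  shows "ideal {b \<in> carrier B. f b \<notin> x}"
  unfolding ideal_def
proof (intro conjI ballI impI)
  fix a b assume *: "a \<in> {b \<in> carrier B. f b \<notin> x}" "b \<in> carrier B" "b \<sqsubseteq> a"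
  then show "b \<in> {b \<in> carrier B. f b \<notin> x}"
    using ultra_mono[OF x _ op_mono[of b a]] op_closed[of a] by blast
qed (use x in \<open>auto simp: op_bot op_join ultra_bot ultra_join op_closed closed\<close>)

lemma crel_refl: "ultra x \<Longrightarrow> crel f x x"
  unfolding crel_def by (metis ultra_mono op_extensive op_closed ultra_carrier)

lemma crel_trans:
  assumes "ultra x" "ultra y" "ultra z" "crel f x y" "crel f y z"
  shows "crel f x z"
  unfolding crel_def
proof
  fix a assume a: "a \<in> z"
  then have "f (f a) \<in> x" using assms unfolding crel_def by blast
  moreover have "a \<in> carrier B" using a assms ultra_carrier by blast
  ultimately show "f a \<in> x" using ultra_mono[OF assms(1) _ op_transitive] op_closed[of a] by blast
qed

lemma crel_between:
  assumes x: "ultra x" and F: "filt F" and *: "\<And>a. a \<in> F \<Longrightarrow> f a \<in> x"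
  obtains y where "ultra y" "F \<subseteq> y" "crel f x y"
proof -
  have "F \<inter> {b \<in> carrier B. f b \<notin> x} = {}" using * by auto
  then obtain y where y: "ultra y" "F \<subseteq> y" "y \<inter> {b \<in> carrier B. f b \<notin> x} = {}"
    using ultra_extension[OF F ideal_preimage[OF x]] by blast
  then have "crel f x y" unfolding crel_def using ultra_carrier[OF y(1)] by blast
  then show thesis using that y by blast
qed

text \<open>This is the modal case of the truth lemma: by monotonicity of \<open>f\<close>, the
  principal filter of \<open>a\<close> meets the condition of \<open>crel_between\<close>.\<close>

lemma crel_iff:
  assumes x: "ultra x" and a: "a \<in> carrier B"
  shows "f a \<in> x \<longleftrightarrow> (\<exists>y. ultra y \<and> crel f x y \<and> a \<in> y)"
proof
  assume fa: "f a \<in> x"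
  let ?F = "{z \<in> carrier B. a \<sqsubseteq> z}"
  have "filt ?F" by (rule filt_principal[OF a])
  moreover have "f b \<in> x" if "b \<in> ?F" for b
    using that fa a ultra_mono[OF x _ op_mono[of a b]] op_closed[of b] by blast
  ultimately obtain y where "ultra y" "?F \<subseteq> y" "crel f x y" using crel_between[OF x] by blast
  then show "\<exists>y. ultra y \<and> crel f x y \<and> a \<in> y" using a leq_refl by blast
qed (auto simp: crel_def)

end

text \<open>If \<open>a \<in> x\<close> but \<open>f a \<notin> y\<close>, the complement of
  \<open>f a\<close> lies in \<open>y\<close>, so \<open>f (neg B (f a)) \<in> x\<close>. But
  \<open>f a \<in> x\<close> by extensivity, and the symmetry axiom then puts the complement of that
  element into \<open>x\<close>.\<close>

lemma (in s5_operator) crel_sym: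
  assumes x: "ultra x" and y: "ultra y" and r: "crel f x y"
  shows "crel f y x"
  unfolding crel_def
proof
  fix a assume a: "a \<in> x"
  then have aB: "a \<in> carrier B" using x ultra_carrier by blast
  show "f a \<in> y"
  proof (rule ccontr)
    assume "f a \<notin> y"
    then have "f (neg B (f a)) \<in> x"
      using r ultra_neg[OF y op_closed[OF aB]] unfolding crel_def by blast
    moreover have "f a \<in> x" using ultra_mono[OF x a op_extensive[OF aB]] op_closed[OF aB] by blast
    then have "neg B (f (neg B (f a))) \<in> x"
      using ultra_mono[OF x _ op_symmetric[OF aB]] by (simp add: op_closed closed aB)
    ultimately show False using ultra_neg[OF x, of "f (neg B (f a))"] by (simp add: op_closed closed aB)
  qed
qed

context ms4_algebra
begin

sublocale s4_operator B "dia B" by (rule dia_s4)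
sublocale E: s5_operator B "ex B" by (rule ex_s5)

text \<open>Transitivity is where the interaction axiom enters:
  \<diamond>\<exists>\<diamond>\<exists>x \<le> \<diamond>\<diamond>\<exists>\<exists>x \<le>
  \<diamond>\<exists>x.\<close>

lemma dia_ex_s4: "s4_operator B (\<lambda>a. dia B (ex B a))"
proof
  fix x assume x: "x \<in> carrier B"
  show "leq B x (dia B (ex B x))"
    using leq_trans[OF E.op_extensive[OF x] op_extensive[OF E.op_closed[OF x]]]
    by (simp add: x op_closed E.op_closed)
  have "leq B (ex B (dia B (ex B x))) (dia B (ex B (ex B x)))"
    using ex_dia_le[OF E.op_closed[OF x]] .
  from op_mono[OF this] have "leq B (dia B (ex B (dia B (ex B x)))) (dia B (dia B (ex B (ex B x))))"
    by (simp_all add: x op_closed E.op_closed)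
  from leq_trans[OF this op_transitive]
  have "leq B (dia B (ex B (dia B (ex B x)))) (dia B (ex B (ex B x)))"
    by (simp_all add: x op_closed E.op_closed)
  from leq_trans[OF this op_mono[OF E.op_transitive]]
  show "leq B (dia B (ex B (dia B (ex B x)))) (dia B (ex B x))"
    by (simp_all add: x op_closed E.op_closed)
qed (simp_all add: op_closed E.op_closed op_bot E.op_bot op_join E.op_join)

lemma sem_closed: "(\<And>i. v i \<in> carrier B) \<Longrightarrow> sem B v p \<in> carrier B"
  by (induction p) (simp_all add: closed op_closed E.op_closed)

text \<open>The intermediate point extends the filter \<open>?F\<close> generated by the elements
  \<open>ex B a\<close> with \<open>a \<in> y\<close>, which puts it in relation \<exists> to
  \<open>y\<close>. The hypothesis says that \<open>dia B\<close> maps these generators into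
  \<open>x\<close>, so \<open>crel_between\<close> applies.\<close>

lemma crel_dia_ex:
  assumes x: "ultra x" and y: "ultra y" and r: "crel (\<lambda>a. dia B (ex B a)) x y"
  obtains w where "ultra w" "crel (dia B) x w" "crel (ex B) w y"
proof -
  let ?F = "{c \<in> carrier B. \<exists>a\<in>y. ex B a \<sqsubseteq> c}"
  have yB: "a \<in> y \<Longrightarrow> a \<in> carrier B" for a using y ultra_carrier by blast
  have "filt ?F" unfolding filt_def
  proof (intro conjI ballI impI)
    show "ba.top B \<in> ?F" using yB ultra_top[OF y] leq_top closed E.op_closed by auto
  next
    fix c d assume "c \<in> ?F" "d \<in> ?F"
    then obtain a b where ab: "a \<in> y" "b \<in> y" "ex B a \<sqsubseteq> c" "ex B b \<sqsubseteq> d"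
      and cd: "c \<in> carrier B" "d \<in> carrier B" by auto
    have aB: "a \<in> carrier B" "b \<in> carrier B" using ab yB by auto
    have "ex B (a \<sqinter> b) \<sqsubseteq> ex B a" "ex B (a \<sqinter> b) \<sqsubseteq> ex B b"
      using aB by (auto intro!: E.op_mono meet_leq1 meet_leq2 closed)
    then have "ex B (a \<sqinter> b) \<sqsubseteq> c \<sqinter> d"
      using ab cd aB by (meson leq_meet leq_trans closed E.op_closed)
    moreover have "a \<sqinter> b \<in> y" using ab aB ultra_meet[OF y] by auto
    ultimately show "c \<sqinter> d \<in> ?F" using cd meet_closed[OF cd] by blast
  next
    fix c d assume "c \<in> ?F" "d \<in> carrier B" "c \<sqsubseteq> d"
    then show "d \<in> ?F" by (auto intro: leq_trans E.op_closed yB)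
  qed auto
  moreover have "dia B c \<in> x" if "c \<in> ?F" for c
  proof -
    from that obtain a where a: "a \<in> y" "ex B a \<sqsubseteq> c" "c \<in> carrier B" by auto
    then have "dia B (ex B a) \<in> x" using r unfolding crel_def by auto
    then show ?thesis using ultra_mono[OF x _ op_mono[OF a(2)]] a(3) by (simp add: a yB E.op_closed op_closed)
  qed
  ultimately obtain w where "ultra w" "?F \<subseteq> w" "crel (dia B) x w" using crel_between[OF x] by blast
  moreover from this have "crel (ex B) w y"
    unfolding crel_def using leq_refl[OF E.op_closed[OF yB]] E.op_closed[OF yB] by blast
  ultimately show thesis using that by blast
qed

lemma dia_ex_s5:
  assumes "valid B (P0 1)"
  shows "s5_operator B (\<lambda>a. dia B (ex B a))"
proof -
  interpret M: s4_operator B "\<lambda>a. dia B (ex B a)" by (rule dia_ex_s4)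
  show ?thesis
  proof
    fix x assume x: "x \<in> carrier B"
    let ?m = "\<lambda>a. dia B (ex B a)"
    \<comment> \<open>With \<open>neg B x\<close> for the variable, its \<box>\<forall> is the
      complement of \<open>?m x\<close>, and the formula becomes the symmetry axiom.\<close>
    have "sem B (\<lambda>_. neg B x) (P0 1) = ba.top B"
      using assms x closed unfolding valid_def sat_eq_def by (auto simp del: One_nat_def)
    then have top: "neg B (?m (neg B (?m x))) \<squnion> neg B (?m x) = ba.top B"
      using x by (simp add: P0_def Imp_def Box_def All_def neg_neg closed E.op_closed op_closed)
    show "leq B (?m x) (neg B (?m (neg B (?m x))))"
    proof (rule leq_if_ultra)
      fix U assume "ultra U" "?m x \<in> U"
      then show "neg B (?m (neg B (?m x))) \<in> U"
        using ultra_top[of U] x unfolding top[symmetric]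
        by (auto simp: ultra_join ultra_neg closed M.op_closed)
    qed (auto simp: x closed M.op_closed)
  qed
qed

end

section \<open>Kripke frames\<close>

primrec fsat :: "'w set \<Rightarrow> ('w \<Rightarrow> 'w \<Rightarrow> bool) \<Rightarrow> ('w \<Rightarrow> 'w \<Rightarrow> bool) \<Rightarrow> (nat \<Rightarrow> 'w set) \<Rightarrow> 'w \<Rightarrow> fm \<Rightarrow> bool"
where
  "fsat W R E V w (Var i) \<longleftrightarrow> w \<in> V i"
| "fsat W R E V w Bot \<longleftrightarrow> False"
| "fsat W R E V w Top \<longleftrightarrow> True"
| "fsat W R E V w (Neg p) \<longleftrightarrow> \<not> fsat W R E V w p"
| "fsat W R E V w (And p q) \<longleftrightarrow> fsat W R E V w p \<and> fsat W R E V w q"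
| "fsat W R E V w (Or p q) \<longleftrightarrow> fsat W R E V w p \<or> fsat W R E V w q"
| "fsat W R E V w (Dia p) \<longleftrightarrow> (\<exists>u\<in>W. R w u \<and> fsat W R E V u p)"
| "fsat W R E V w (fm.Ex p) \<longleftrightarrow> (\<exists>u\<in>W. E w u \<and> fsat W R E V u p)"

text \<open>Depth at most \<open>n\<close> means that no point satisfies \<open>chain W R n\<close>.\<close>

primrec chain :: "'w set \<Rightarrow> ('w \<Rightarrow> 'w \<Rightarrow> bool) \<Rightarrow> nat \<Rightarrow> 'w \<Rightarrow> bool" where
  "chain W R 0 x \<longleftrightarrow> True"
| "chain W R (Suc k) x \<longleftrightarrow> (\<exists>y\<in>W. R x y \<and> \<not> R y x \<and> chain W R k y)"

text \<open>Variables beyond the index do not occur in the depth formula, so the induction below may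
  reassign the next one.\<close>

lemma sem_depth_fm_cong:
  "(\<And>i. i \<le> n \<Longrightarrow> v i = w i) \<Longrightarrow> sem B v (depth_fm Dia Box n) = sem B w (depth_fm Dia Box n)"
  by (induction "Dia" "Box" n rule: depth_fm.induct) (auto simp: Imp_def Box_def)

text \<open>A strict step from \<open>x\<close> to \<open>y\<close> is witnessed by some
  \<open>a \<in> x\<close> with \<open>dia B a \<notin> y\<close>. With value \<open>neg B a\<close>
  for the last variable, its \<box> is the complement of \<open>dia B a\<close>, which lies in
  \<open>y\<close> but not in \<open>x\<close>. The rest of the chain refutes the preceding depth
  formula at \<open>y\<close>.\<close>

lemma (in ms4_algebra) chain_refutes_depth_fm:
  "\<lbrakk>ultra x; chain {x. ultra x} (crel (dia B)) (Suc n) x\<rbrakk>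
    \<Longrightarrow> \<exists>v. (\<forall>i. v i \<in> carrier B) \<and> sem B v (P (Suc n)) \<notin> x"
proof (induction n arbitrary: x)
  case (0 x)
  then obtain y where y: "ultra y" "crel (dia B) x y" "\<not> crel (dia B) y x" by auto
  then obtain a where a: "a \<in> x" "dia B a \<notin> y" by (auto simp: crel_def)
  have aB: "a \<in> carrier B" using a 0 ultra_carrier by blast
  have "dia B a \<in> x" using 0 a crel_refl crel_def by metis
  moreover have "dia B (neg B (dia B a)) \<in> x"
    using y a ultra_neg[OF y(1) op_closed[OF aB]] unfolding crel_def by blast
  ultimately have "sem B (\<lambda>_. neg B a) (P (Suc 0)) \<notin> x"
    using aB 0 by (simp add: P_def Imp_def Box_def neg_neg ultra_join ultra_neg closed op_closed)
  then show ?case using neg_closed[OF aB] by (intro exI[of _ "\<lambda>_. neg B a"]) simp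
next
  case (Suc n x)
  then obtain y where y: "ultra y" "crel (dia B) x y" "\<not> crel (dia B) y x"
    and c: "chain {x. ultra x} (crel (dia B)) (Suc n) y" by auto
  obtain v where v: "\<And>i. v i \<in> carrier B" "sem B v (P (Suc n)) \<notin> y"
    using Suc.IH[OF y(1) c] by blast
  obtain a where a: "a \<in> x" "dia B a \<notin> y" using y by (auto simp: crel_def)
  have aB: "a \<in> carrier B" using a Suc ultra_carrier by blast
  have xa: "dia B a \<in> x" using Suc a crel_refl crel_def by metis
  let ?v = "v(Suc (Suc n) := neg B a)"
  let ?s = "sem B v (depth_fm Dia Box (Suc n))"
  have s: "sem B ?v (depth_fm Dia Box (Suc n)) = ?s"
    by (rule sem_depth_fm_cong) auto
  have sB: "?s \<in> carrier B" by (rule sem_closed) (rule v)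
  have "neg B (dia B a) \<sqinter> neg B ?s \<in> y"
    using v(2) y a aB sB by (simp add: ultra_meet ultra_neg closed op_closed P_def)
  then have "dia B (neg B (dia B a) \<sqinter> neg B ?s) \<in> x"
    using y unfolding crel_def by blast
  then have "sem B ?v (P (Suc (Suc n))) \<notin> x"
    using xa aB sB Suc.prems(1) s
    by (simp add: P_def Imp_def Box_def neg_neg ultra_join ultra_neg closed op_closed)
  then show ?case using v(1) neg_closed[OF aB] by (metis fun_upd_apply)
qed

text \<open>Totality of \<open>R\<close> followed by \<open>E\<close> makes both the interaction axiom and the formula for depth 1 of
  the composed modality trivially true, so that it is the only condition that has to survive a
  passage to a quotient.\<close>

locale total_frame =
  fixes W :: "'w set" and R E :: "'w \<Rightarrow> 'w \<Rightarrow> bool"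
  assumes R_refl: "x \<in> W \<Longrightarrow> R x x"
    and R_trans: "\<lbrakk>x \<in> W; y \<in> W; z \<in> W; R x y; R y z\<rbrakk> \<Longrightarrow> R x z"
    and E_refl: "x \<in> W \<Longrightarrow> E x x"
    and E_sym: "\<lbrakk>x \<in> W; y \<in> W; E x y\<rbrakk> \<Longrightarrow> E y x"
    and E_trans: "\<lbrakk>x \<in> W; y \<in> W; z \<in> W; E x y; E y z\<rbrakk> \<Longrightarrow> E x z"
    and total: "\<lbrakk>x \<in> W; y \<in> W\<rbrakk> \<Longrightarrow> \<exists>w\<in>W. R x w \<and> E w y"
begin

text \<open>If \<box>\<forall>q holds at one point, then q holds everywhere, since \<open>R\<close>
  followed by \<open>E\<close> reaches all of \<open>W\<close>.\<close>

lemma fsat_P0: "w \<in> W \<Longrightarrow> fsat W R E V w (P0 1)"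
  by (auto simp: P0_def Imp_def Box_def All_def) (metis total E_sym)+

text \<open>In a refutation at \<open>w\<close>, some \<open>u\<close> seen from \<open>w\<close>
  satisfies \<box>q while \<open>w\<close> does not, so transitivity forbids a return from
  \<open>u\<close> to \<open>w\<close>. Each level of nesting thus contributes one strict
  step.\<close>

lemma chain_if_not_fsat_P:
  "\<lbrakk>w \<in> W; \<not> fsat W R E V w (P (Suc k))\<rbrakk> \<Longrightarrow> chain W R (Suc k) w"
proof (induction k arbitrary: w)
  case 0
  then show ?case by (auto simp: P_def Imp_def Box_def) (metis R_trans)
next
  case (Suc k)
  let ?i = "Suc (Suc k)"
  from Suc.prems obtain u where u: "u \<in> W" "R w u" "\<forall>z\<in>W. R u z \<longrightarrow> z \<in> V ?i"
      "\<not> fsat W R E V u (P (Suc k))" and nw: "\<exists>z\<in>W. R w z \<and> z \<notin> V ?i"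
    by (auto simp: P_def Imp_def Box_def)
  then have "\<not> R u w" using Suc.prems(1) R_trans by blast
  then show ?case using u Suc.IH[OF u(1,4)] by auto
qed

end

section \<open>The complex algebra of a finite frame\<close>

text \<open>Subsets are coded as numbers because the finite members in \<open>has_fmp\<close> live
  on \<open>nat\<close>. The coding is faithful only for finite \<open>W\<close>.\<close>

definition cm :: "nat set \<Rightarrow> (nat \<Rightarrow> nat \<Rightarrow> bool) \<Rightarrow> (nat \<Rightarrow> nat \<Rightarrow> bool) \<Rightarrow> nat ms4" where
  "cm W R E = \<lparr>carrier = set_encode ` Pow W,
    meet = \<lambda>x y. set_encode (set_decode x \<inter> set_decode y),
    join = \<lambda>x y. set_encode (set_decode x \<union> set_decode y),
    neg = \<lambda>x. set_encode (W - set_decode x),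
    bot = set_encode {}, top = set_encode W,
    dia = \<lambda>x. set_encode {w \<in> W. \<exists>u\<in>W. R w u \<and> u \<in> set_decode x},
    ex = \<lambda>x. set_encode {w \<in> W. \<exists>u\<in>W. E w u \<and> u \<in> set_decode x}\<rparr>"

locale finite_total_frame = total_frame W R E
  for W :: "nat set" and R E :: "nat \<Rightarrow> nat \<Rightarrow> bool" +
  assumes fin: "finite W"
begin

lemma decode_encode: "A \<subseteq> W \<Longrightarrow> set_decode (set_encode A) = A"
  using fin finite_subset set_encode_inverse by blast

lemma encode_eq: "\<lbrakk>A \<subseteq> W; C \<subseteq> W\<rbrakk> \<Longrightarrow> set_encode A = set_encode C \<longleftrightarrow> A = C"
  by (metis decode_encode)

lemma in_cmE:
  assumes "x \<in> carrier (cm W R E)" obtains A where "x = set_encode A" "A \<subseteq> W"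
  using assms by (auto simp: cm_def)

lemma cm_simps:
  "ba.bot (cm W R E) = set_encode {}" "ba.top (cm W R E) = set_encode W"
  "\<lbrakk>A \<subseteq> W; C \<subseteq> W\<rbrakk> \<Longrightarrow> meet (cm W R E) (set_encode A) (set_encode C) = set_encode (A \<inter> C)"
  "\<lbrakk>A \<subseteq> W; C \<subseteq> W\<rbrakk> \<Longrightarrow> join (cm W R E) (set_encode A) (set_encode C) = set_encode (A \<union> C)"
  "A \<subseteq> W \<Longrightarrow> neg (cm W R E) (set_encode A) = set_encode (W - A)"
  "A \<subseteq> W \<Longrightarrow> dia (cm W R E) (set_encode A) = set_encode {w \<in> W. \<exists>u\<in>W. R w u \<and> u \<in> A}"
  "A \<subseteq> W \<Longrightarrow> ex (cm W R E) (set_encode A) = set_encode {w \<in> W. \<exists>u\<in>W. E w u \<and> u \<in> A}"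
  "\<lbrakk>A \<subseteq> W; C \<subseteq> W\<rbrakk> \<Longrightarrow> leq (cm W R E) (set_encode A) (set_encode C) \<longleftrightarrow> A \<subseteq> C"
proof -
  show "leq (cm W R E) (set_encode A) (set_encode C) \<longleftrightarrow> A \<subseteq> C" if "A \<subseteq> W" "C \<subseteq> W"
    using that encode_eq[of "A \<inter> C" A] by (auto simp: cm_def leq_def decode_encode)
qed (simp_all add: cm_def decode_encode del: set_encode_empty)

lemma in_cm: "A \<subseteq> W \<Longrightarrow> set_encode A \<in> carrier (cm W R E)"
  by (auto simp: cm_def)

lemma boolean_alg_cm: "boolean_alg (cm W R E)"
proof
qed (auto elim!: in_cmE simp: cm_simps le_infI1 Diff_subset encode_eq simp del: set_encode_empty
    intro!: in_cm arg_cong[of _ _ set_encode])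

text \<open>The operator axioms reflect that \<open>R\<close> is a preorder and \<open>E\<close> an
  equivalence. The interaction axiom holds by totality: from any point, every point of
  \<open>W\<close> is reached by \<open>R\<close> and then \<open>E\<close>.\<close>

lemma ms4_cm: "ms4_algebra (cm W R E)"
proof -
  interpret boolean_alg "cm W R E" by (rule boolean_alg_cm)
  have sub: "{w \<in> W. Q w} \<subseteq> W" for Q by auto
  show ?thesis
  proof
    fix x assume "x \<in> carrier (cm W R E)"
    then obtain A where A: "x = set_encode A" "A \<subseteq> W" by (rule in_cmE)
    show "leq (cm W R E) x (dia (cm W R E) x)"
      using A by (auto simp: cm_simps sub intro: R_refl)
    show "leq (cm W R E) (dia (cm W R E) (dia (cm W R E) x)) (dia (cm W R E) x)"
      using A by (auto simp: cm_simps sub) (metis R_trans)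
    show "leq (cm W R E) x (ex (cm W R E) x)"
      using A by (auto simp: cm_simps sub intro: E_refl)
    show "leq (cm W R E) (ex (cm W R E) (ex (cm W R E) x)) (ex (cm W R E) x)"
      using A by (auto simp: cm_simps sub) (metis E_trans)
    show "leq (cm W R E) (ex (cm W R E) x)
        (neg (cm W R E) (ex (cm W R E) (neg (cm W R E) (ex (cm W R E) x))))"
      using A by (auto simp: cm_simps sub) (metis E_trans E_sym)
    show "leq (cm W R E) (ex (cm W R E) (dia (cm W R E) x)) (dia (cm W R E) (ex (cm W R E) x))"
      using A by (auto simp: cm_simps sub) (metis total subsetD)
    show "dia (cm W R E) x \<in> carrier (cm W R E)" "ex (cm W R E) x \<in> carrier (cm W R E)"
      using A by (auto simp: cm_simps sub intro!: in_cm)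
    fix y assume "y \<in> carrier (cm W R E)"
    then obtain C where C: "y = set_encode C" "C \<subseteq> W" by (rule in_cmE)
    show "dia (cm W R E) (join (cm W R E) x y) = join (cm W R E) (dia (cm W R E) x) (dia (cm W R E) y)"
      "ex (cm W R E) (join (cm W R E) x y) = join (cm W R E) (ex (cm W R E) x) (ex (cm W R E) y)"
      using A C by (auto simp: cm_simps sub intro!: arg_cong[of _ _ set_encode])
  qed (auto simp: cm_simps simp del: set_encode_empty)
qed

text \<open>Cutting \<open>V i\<close> down to \<open>W\<close> makes each value an element of the
  algebra, whatever \<open>V\<close> is.\<close>

lemma sem_cm:
  "sem (cm W R E) (\<lambda>i. set_encode {w \<in> W. w \<in> V i}) p = set_encode {w \<in> W. fsat W R E V w p}"
proof -
  have sub: "{w \<in> W. Q w} \<subseteq> W" for Q by auto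
  show ?thesis
    by (induction p) (auto simp: cm_simps sub simp del: set_encode_empty intro!: arg_cong[of _ _ set_encode])
qed

lemma cm_validI:
  assumes "\<And>V w. w \<in> W \<Longrightarrow> fsat W R E V w p"
  shows "valid (cm W R E) p"
  unfolding valid_def sat_eq_def
proof (intro allI impI)
  fix v :: "nat \<Rightarrow> nat" assume v: "\<forall>i. v i \<in> carrier (cm W R E)"
  \<comment> \<open>Every valuation in the algebra comes from the frame valuation that decodes it,
    so \<open>sem_cm\<close> applies.\<close>
  have "v i = set_encode {w \<in> W. w \<in> set_decode (v i)}" for i
  proof -
    from v obtain A where "v i = set_encode A" "A \<subseteq> W" by (meson in_cmE)
    then show ?thesis by (simp add: decode_encode) (metis Collect_mem_eq Int_absorb1 Int_def)
  qed
  then have v_eq: "v = (\<lambda>i. set_encode {w \<in> W. w \<in> (\<lambda>i. set_decode (v i)) i})" by auto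
  show "sem (cm W R E) v p = sem (cm W R E) v Top"
    by (subst (1 2) v_eq, unfold sem_cm) (simp add: assms cong: conj_cong)
qed

lemma cm_in_variety:
  assumes "n \<ge> 1" and "\<And>w. w \<in> W \<Longrightarrow> \<not> chain W R n w"
  shows "in_variety (MS4S n) (cm W R E)"
proof -
  \<comment> \<open>\<open>P 0\<close> is the dummy \<open>Bot\<close>; the link between chains and
    depth formulas starts at index 1.\<close>
  obtain k where "n = Suc k" using assms(1) by (cases n) auto
  then have "valid (cm W R E) (P n)" using assms(2) chain_if_not_fsat_P cm_validI by metis
  then show ?thesis unfolding in_variety_def MS4S_def
    using ms4_cm cm_validI[OF fsat_P0] by auto
qed

end

section \<open>A finite quotient of a frame of finite depth\<close>

context
  fixes W :: "'w set" and R :: "'w \<Rightarrow> 'w \<Rightarrow> bool" and \<sigma> :: "'w \<Rightarrow> nat"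
begin

definition clust :: "'w \<Rightarrow> 'w set" where "clust x = {z \<in> W. R x z \<and> R z x}"
definition above :: "'w \<Rightarrow> 'w set" where "above x = {z \<in> W. R x z \<and> \<not> R z x}"

text \<open>Stage 0 records nothing, not even \<open>\<sigma>\<close>. On points without a chain of
  \<open>k\<close> steps, stage \<open>k\<close> determines the next stage, by
  \<open>col_stable\<close>.\<close>

primrec col :: "nat \<Rightarrow> 'w \<Rightarrow> nat" where
  "col 0 x = 0"
| "col (Suc k) x =
    prod_encode (\<sigma> x, prod_encode (set_encode (\<sigma> ` clust x), set_encode (col k ` above x)))"

context
  assumes fin: "finite (\<sigma> ` W)"
    and refl: "\<And>x. x \<in> W \<Longrightarrow> R x x"
    and trans: "\<And>x y z. \<lbrakk>x \<in> W; y \<in> W; z \<in> W; R x y; R y z\<rbrakk> \<Longrightarrow> R x z"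
begin

lemma finite_col: "finite (col k ` W)"
proof (induction k)
  case 0
  then show ?case by (rule finite_subset[of _ "{0}"]) auto
next
  case (Suc k)
  let ?S = "prod_encode ` (\<sigma> ` W \<times>
    prod_encode ` (set_encode ` Pow (\<sigma> ` W) \<times> set_encode ` Pow (col k ` W)))"
  have "finite ?S" using fin Suc by simp
  moreover have "col (Suc k) ` W \<subseteq> ?S" by (auto simp: clust_def above_def)
  ultimately show ?case by (rule rev_finite_subset)
qed

lemma col_Suc_eq:
  "col (Suc k) x = col (Suc k) y \<longleftrightarrow>
    \<sigma> x = \<sigma> y \<and> \<sigma> ` clust x = \<sigma> ` clust y \<and> col k ` above x = col k ` above y"
proof -
  have "finite (\<sigma> ` clust z)" for z
    by (rule finite_subset[OF _ fin]) (auto simp: clust_def)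
  moreover have "finite (col k ` above z)" for z
    by (rule finite_subset[OF _ finite_col[of k]]) (auto simp: above_def)
  ultimately show ?thesis by (simp add: prod_encode_eq set_encode_eq)
qed

text \<open>Points strictly above \<open>x\<close> or \<open>y\<close> start only shorter chains.
  Those matched at stage \<open>k\<close> therefore match at stage \<open>Suc k\<close> by
  induction, so the sets of colours above still agree one stage later.\<close>

lemma col_stable:
  "\<lbrakk>\<not> chain W R k x; \<not> chain W R k y; col k x = col k y\<rbrakk> \<Longrightarrow> col (Suc k) x = col (Suc k) y"
proof (induction k arbitrary: x y)
  case 0
  then show ?case by simp
next
  case (Suc k)
  have nc: "\<not> chain W R k z" if "z \<in> above x \<union> above y" for z
    using Suc.prems(1,2) that by (auto simp: above_def)
  have eq: "\<sigma> x = \<sigma> y" "\<sigma> ` clust x = \<sigma> ` clust y" "col k ` above x = col k ` above y"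
    using Suc.prems(3) unfolding col_Suc_eq by auto
  have "col (Suc k) ` above u \<subseteq> col (Suc k) ` above w"
    if uw: "{u, w} \<subseteq> {x, y}" and im: "col k ` above u = col k ` above w" for u w
  proof (rule image_subsetI)
    fix z assume z: "z \<in> above u"
    then obtain z' where z': "z' \<in> above w" "col k z = col k z'" using im by blast
    have "col (Suc k) z = col (Suc k) z'"
      by (rule Suc.IH) (use z z' uw nc in auto)
    then show "col (Suc k) z \<in> col (Suc k) ` above w" using z' by blast
  qed
  from this[of x y] this[of y x] have "col (Suc k) ` above x = col (Suc k) ` above y"
    using eq by auto
  then show ?case using eq by (subst col_Suc_eq) blast
qed

text \<open>A successor in the cluster of \<open>x\<close> is matched through
  \<open>\<sigma>\<close> in the cluster of \<open>x'\<close>; one strictly above is matched at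
  stage \<open>k\<close> and promoted by \<open>col_stable\<close>.\<close>

lemma col_bisim:
  assumes x: "x \<in> W" "x' \<in> W" "col (Suc k) x = col (Suc k) x'"
    and nc: "\<not> chain W R (Suc k) x" "\<not> chain W R (Suc k) x'" and y: "y \<in> W" "R x y"
  obtains y' where "y' \<in> W" "R x' y'" "col (Suc k) y' = col (Suc k) y"
proof -
  have eq: "\<sigma> ` clust x = \<sigma> ` clust x'" "col k ` above x = col k ` above x'"
    using x(3) unfolding col_Suc_eq by auto
  \<comment> \<open>Within a cluster, colours differ only in their \<open>\<sigma>\<close>
    component.\<close>
  have inv: "clust b = clust a \<and> above b = above a" if "a \<in> W" "b \<in> clust a" for a b
    using that trans unfolding clust_def above_def by blast
  show thesis
  proof (cases "R y x")
    case True
    then have yc: "y \<in> clust x" using y by (auto simp: clust_def)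
    then obtain y' where y': "y' \<in> clust x'" "\<sigma> y' = \<sigma> y" using eq by (metis imageE image_eqI)
    then have "col (Suc k) y' = col (Suc k) y"
      unfolding col_Suc_eq using inv[OF x(1) yc] inv[OF x(2) y'(1)] eq by simp
    then show thesis using that y' by (auto simp: clust_def)
  next
    case False
    then have ya: "y \<in> above x" using y by (auto simp: above_def)
    then obtain y' where y': "y' \<in> above x'" "col k y' = col k y" using eq by (metis imageE image_eqI)
    moreover have "\<not> chain W R k y" "\<not> chain W R k y'"
      using nc ya y'(1) by (auto simp: above_def)
    ultimately have "col (Suc k) y' = col (Suc k) y" using col_stable by blast
    then show thesis using that y' by (auto simp: above_def)
  qed
qed

end

end

section \<open>The quotient preserving truth of finitely many formulas\<close>

primrec subfms :: "fm \<Rightarrow> fm set" where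
  "subfms (Var i) = {Var i}"
| "subfms Bot = {Bot}"
| "subfms Top = {Top}"
| "subfms (Neg p) = insert (Neg p) (subfms p)"
| "subfms (And p q) = insert (And p q) (subfms p \<union> subfms q)"
| "subfms (Or p q) = insert (Or p q) (subfms p \<union> subfms q)"
| "subfms (Dia p) = insert (Dia p) (subfms p)"
| "subfms (fm.Ex p) = insert (fm.Ex p) (subfms p)"

lemma finite_subfms: "finite (subfms p)"
  by (induction p) auto

text \<open>The map \<open>f\<close> sends a point to its colour. It is a bounded morphism for
  \<open>R\<close>, whereas \<exists> is treated as in a filtration.\<close>

lemma (in total_frame) finite_quotient:
  fixes V :: "nat \<Rightarrow> 'w set" and n :: nat
  assumes n: "n \<ge> 1" and nc: "\<And>x. x \<in> W \<Longrightarrow> \<not> chain W R n x" and S: "finite S"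
  obtains f R' E' V' where "finite_total_frame (f ` W) R' E'"
    and "\<And>x. x \<in> W \<Longrightarrow> \<not> chain (f ` W) R' n (f x)"
    and "\<And>x p. \<lbrakk>x \<in> W; subfms p \<subseteq> S\<rbrakk> \<Longrightarrow> fsat (f ` W) R' E' V' (f x) p \<longleftrightarrow> fsat W R E V x p"
proof -
  let ?t = "fsat W R E V"
  obtain k where k: "n = Suc k" using n by (cases n) auto
  obtain g :: "fm set \<Rightarrow> nat" where g: "inj_on g (Pow S)"
    using finite_imp_inj_to_nat_seg[of "Pow S"] S by auto
  define \<sigma> where "\<sigma> x = g {p \<in> S. ?t x p}" for x
  have "\<sigma> ` W \<subseteq> g ` Pow S" by (auto simp: \<sigma>_def)
  then have fin: "finite (\<sigma> ` W)" using S finite_subset by blast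
  \<comment> \<open>As no point starts a chain of \<open>n\<close> steps, \<open>col_bisim\<close>
    applies at stage \<open>n\<close>; being a successor stage, it records
    \<open>\<sigma>\<close>.\<close>
  define f where "f = col W R \<sigma> n"
  have fS: "?t x p \<longleftrightarrow> ?t y p" if "f x = f y" "p \<in> S" for x y p
  proof -
    have "\<sigma> x = \<sigma> y" using that unfolding f_def k by (simp add: prod_encode_eq)
    then have "{p \<in> S. ?t x p} = {p \<in> S. ?t y p}"
      unfolding \<sigma>_def using inj_onD[OF g] by blast
    then show ?thesis using that by blast
  qed
  define R' where "R' a b \<longleftrightarrow> (\<exists>x\<in>W. \<exists>y\<in>W. f x = a \<and> f y = b \<and> R x y)" for a b
  \<comment> \<open>The choice of representatives is immaterial because colours determine truth of
    all formulas in \<open>S\<close>.\<close>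
  define E' where "E' a b \<longleftrightarrow> (\<exists>x\<in>W. \<exists>y\<in>W. f x = a \<and> f y = b
      \<and> (\<forall>p. fm.Ex p \<in> S \<longrightarrow> ?t x (fm.Ex p) = ?t y (fm.Ex p)))" for a b
  \<comment> \<open>Variables outside \<open>S\<close> get the empty set.\<close>
  define V' where "V' i = {a. Var i \<in> S \<and> (\<exists>x\<in>W. f x = a \<and> x \<in> V i)}" for i
  \<comment> \<open>The bisimulation property moves a step between some representatives to the given
    representative \<open>x\<close>; this is what makes \<open>R'\<close> transitive.\<close>
  have R'_iff: "R' (f x) b \<longleftrightarrow> (\<exists>y\<in>W. R x y \<and> f y = b)" if x: "x \<in> W" for x b
  proof
    assume "R' (f x) b"
    then obtain x1 y1 where 1: "x1 \<in> W" "y1 \<in> W" "f x1 = f x" "f y1 = b" "R x1 y1"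
      unfolding R'_def by blast
    obtain y where "y \<in> W" "R x y" "f y = f y1"
    proof (rule col_bisim[OF fin R_refl R_trans])
      show "col W R \<sigma> (Suc k) x1 = col W R \<sigma> (Suc k) x" using 1 by (simp add: f_def k)
    qed (use 1 x nc in \<open>auto simp: f_def k\<close>)
    then show "\<exists>y\<in>W. R x y \<and> f y = b" using 1 by blast
  qed (use x in \<open>auto simp: R'_def\<close>)
  have E'_iff: "E' (f x) (f y) \<longleftrightarrow> (\<forall>p. fm.Ex p \<in> S \<longrightarrow> ?t x (fm.Ex p) = ?t y (fm.Ex p))"
    if xy: "x \<in> W" "y \<in> W" for x y
  proof
    assume "E' (f x) (f y)"
    then obtain x1 y1 where 1: "f x1 = f x" "f y1 = f y"
        "\<And>p. fm.Ex p \<in> S \<Longrightarrow> ?t x1 (fm.Ex p) = ?t y1 (fm.Ex p)"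
      unfolding E'_def by blast
    show "\<forall>p. fm.Ex p \<in> S \<longrightarrow> ?t x (fm.Ex p) = ?t y (fm.Ex p)"
      using 1(3) fS[OF 1(1)] fS[OF 1(2)] by blast
  qed (use xy in \<open>auto simp only: E'_def\<close>)
  \<comment> \<open>\<open>E\<close>-related points satisfy the same formulas beginning with
    \<exists>, as \<open>E\<close> is an equivalence; so \<open>E'\<close> contains the image of
    \<open>E\<close>.\<close>
  have E'I: "E' (f x) (f y)" if "x \<in> W" "y \<in> W" "E x y" for x y
    using that by (auto simp: E'_iff) (meson E_trans E_sym)+
  have "finite_total_frame (f ` W) R' E'"
  proof
    show "finite (f ` W)" unfolding f_def by (rule finite_col[OF fin R_refl R_trans])
    fix a b assume "a \<in> f ` W" "b \<in> f ` W"
    then obtain x y where xy: "x \<in> W" "y \<in> W" "a = f x" "b = f y" by blast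
    then obtain w where "w \<in> W" "R x w" "E w y" using total by blast
    then show "\<exists>w\<in>f ` W. R' a w \<and> E' w b" using xy R'_iff E'I by blast
  next
    fix a b c assume "a \<in> f ` W" "b \<in> f ` W" "c \<in> f ` W" "R' a b" "R' b c"
    then obtain x y z where "x \<in> W" "y \<in> W" "z \<in> W" "a = f x" "b = f y" "c = f z" "R x y" "R y z"
      using R'_iff by (smt (verit, best) imageE)
    then show "R' a c" using R'_iff R_trans by blast
    next
    fix a assume "a \<in> f ` W"
    then show "R' a a" using R'_iff R_refl by blast
  qed (auto simp: E'_iff)
  moreover have "\<not> chain (f ` W) R' n (f x)" if x: "x \<in> W" for x
  proof -
    \<comment> \<open>Chains of the quotient lift step by step; a return upstairs would project to
      one below, so strictness is kept.\<close>
    have "chain (f ` W) R' m (f x) \<Longrightarrow> chain W R m x" if "x \<in> W" for m x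
      using that
    proof (induction m arbitrary: x)
      case (Suc m)
      then obtain b where b: "R' (f x) b" "\<not> R' b (f x)" "chain (f ` W) R' m b" by auto
      then obtain y where y: "y \<in> W" "R x y" "f y = b" using R'_iff Suc.prems by blast
      moreover have "\<not> R y x" using b(2) y Suc.prems R'_iff by blast
      moreover have "chain W R m y" using Suc.IH y b(3) by blast
      ultimately show ?case by auto
    qed simp
    then show ?thesis using nc x by blast
  qed
  moreover have "fsat (f ` W) R' E' V' (f x) p \<longleftrightarrow> ?t x p" if "x \<in> W" "subfms p \<subseteq> S" for x p
    using that
  proof (induction p arbitrary: x)
    case (Var i)
    then have "Var i \<in> S" by auto
    then have "y \<in> V i \<longleftrightarrow> x \<in> V i" if "f y = f x" for y using fS[OF that] by fastforce
    then have "f x \<in> V' i \<longleftrightarrow> x \<in> V i"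
      using Var.prems(1) \<open>Var i \<in> S\<close> unfolding V'_def by blast
    then show ?case by simp
  next
    case (Dia p)
    then have IH: "fsat (f ` W) R' E' V' (f y) p \<longleftrightarrow> ?t y p" if "y \<in> W" for y using that by simp
    have "fsat (f ` W) R' E' V' (f x) (Dia p) \<longleftrightarrow> (\<exists>y\<in>W. R' (f x) (f y) \<and> ?t y p)"
      using IH by (simp cong: conj_cong)
    also have "\<dots> \<longleftrightarrow> (\<exists>y\<in>W. R x y \<and> ?t y p)"
    proof
      assume "\<exists>y\<in>W. R' (f x) (f y) \<and> ?t y p"
      \<comment> \<open>The lifted successor \<open>z\<close> may differ from \<open>y\<close>, but
        both have the same image, so the induction hypothesis transfers truth of
        \<open>p\<close>.\<close>
      then obtain y z where "y \<in> W" "?t y p" "z \<in> W" "R x z" "f z = f y"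
        using R'_iff Dia.prems(1) by blast
      then show "\<exists>y\<in>W. R x y \<and> ?t y p" using IH by metis
    qed (use R'_iff Dia.prems(1) in blast)
    finally show ?case by simp
  next
    case (Ex p)
    then have S: "fm.Ex p \<in> S" by auto
    show ?case
    proof
      assume "fsat (f ` W) R' E' V' (f x) (fm.Ex p)"
      then obtain y where y: "y \<in> W" "E' (f x) (f y)" "?t y p" using Ex by auto
      \<comment> \<open>Reflexivity of \<open>E\<close> turns \<open>p\<close> at \<open>y\<close>
        into \<exists>p, which \<open>E'\<close> carries over to \<open>x\<close>.\<close>
      then have "?t y (fm.Ex p)" using E_refl by auto
      then show "?t x (fm.Ex p)" using y Ex S E'_iff by blast
    next
      assume "?t x (fm.Ex p)"
      then show "fsat (f ` W) R' E' V' (f x) (fm.Ex p)" using Ex E'I by auto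
    qed
  qed auto
  ultimately show thesis using that by blast
qed

section \<open>The finite model property\<close>

lemma chain_mono: "\<lbrakk>chain X R k x; X \<subseteq> Y\<rbrakk> \<Longrightarrow> chain Y R k x"
  by (induction k arbitrary: x) auto

text \<open>\<open>X\<close> is the class, under the canonical relation of \<diamond>\<exists>, of
  an ultrafilter that separates the two values. Any two of its points are related by
  \<diamond>\<exists>, and \<open>crel_dia_ex\<close> factors this relation.\<close>

lemma (in ms4_algebra) refuting_total_frame:
  assumes P0: "valid B (P0 1)" and Pn: "valid B (P n)" and n: "n \<ge> 1"
    and v: "\<And>i. v i \<in> carrier B" and ne: "sem B v s \<noteq> sem B v t"
  obtains X V x where "total_frame X (crel (dia B)) (crel (ex B))"
    and "\<And>x. x \<in> X \<Longrightarrow> \<not> chain X (crel (dia B)) n x" and "x \<in> X"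
    and "fsat X (crel (dia B)) (crel (ex B)) V x s \<noteq> fsat X (crel (dia B)) (crel (ex B)) V x t"
proof -
  let ?R = "crel (dia B)" and ?E = "crel (ex B)" and ?Q = "crel (\<lambda>a. dia B (ex B a))"
  interpret Q: s5_operator B "\<lambda>a. dia B (ex B a)" by (rule dia_ex_s5[OF P0])
  obtain x0 where x0: "ultra x0" "(sem B v s \<in> x0) \<noteq> (sem B v t \<in> x0)"
    using eq_if_ultra[OF sem_closed sem_closed, of v v s t] v ne by blast
  define X where "X = {x. ultra x \<and> ?Q x0 x}"
  define V where "V i = {x. v i \<in> x}" for i
  have RQ: "?Q x y" if "ultra x" "ultra y" "?R x y" for x y
    unfolding crel_def
  proof
    fix a assume "a \<in> y"
    moreover from this have a: "a \<in> carrier B" using that ultra_carrier by blast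
    ultimately have "ex B a \<in> y" using that E.crel_refl[of y] unfolding crel_def by blast
    then show "dia B (ex B a) \<in> x" using that unfolding crel_def by blast
  qed
  have EQ: "?Q x y" if "ultra x" "ultra y" "?E x y" for x y
    unfolding crel_def
  proof
    fix a assume "a \<in> y"
    then have "ex B a \<in> x" using that unfolding crel_def by blast
    then show "dia B (ex B a) \<in> x" using that crel_refl[of x] unfolding crel_def by blast
  qed
  \<comment> \<open>Both relations lie inside \<open>?Q\<close>, so \<open>X\<close> is a generated
    subframe and modal truth can be computed inside it.\<close>
  have up: "y \<in> X" if "x \<in> X" "ultra y" "?R x y \<or> ?E x y" for x y
    using that RQ EQ Q.crel_trans[OF x0(1)] unfolding X_def by blast
  have frame: "total_frame X ?R ?E"
  proof
    fix x y assume xy: "x \<in> X" "y \<in> X"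
    then have "?Q x y"
      using Q.crel_sym Q.crel_trans x0(1) unfolding X_def by blast
    then obtain w where "ultra w" "?R x w" "?E w y"
      using crel_dia_ex xy unfolding X_def by blast
    then show "\<exists>w\<in>X. ?R x w \<and> ?E w y" using up xy by blast
  qed (auto simp: X_def intro: crel_refl E.crel_refl crel_trans E.crel_trans E.crel_sym)
  have nc: "\<not> chain X ?R n x" if x: "x \<in> X" for x
  proof
    assume "chain X ?R n x"
    \<comment> \<open>A chain in \<open>X\<close> is also one among all ultrafilters, where it
      yields a valuation refuting \<open>P n\<close>.\<close>
    then have c: "chain {x. ultra x} ?R n x" by (rule chain_mono) (auto simp: X_def)
    obtain k where k: "n = Suc k" using n by (cases n) auto
    have ux: "ultra x" using x by (simp add: X_def)
    then obtain w where "\<forall>i. w i \<in> carrier B" "sem B w (P n) \<notin> x"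
      using chain_refutes_depth_fm[of x k] c k by blast
    then show False using Pn ultra_top[OF ux] unfolding valid_def sat_eq_def by simp
  qed
  have truth: "fsat X ?R ?E V x p \<longleftrightarrow> sem B v p \<in> x" if "x \<in> X" for x p
    using that
  proof (induction p arbitrary: x)
    case (Dia p)
    then have "ultra x" by (simp add: X_def)
    then have "sem B v (Dia p) \<in> x \<longleftrightarrow> (\<exists>y. ultra y \<and> ?R x y \<and> sem B v p \<in> y)"
      using crel_iff[OF _ sem_closed] v by simp
    also have "\<dots> \<longleftrightarrow> (\<exists>y\<in>X. ?R x y \<and> sem B v p \<in> y)"
      using up[OF Dia.prems] by (auto simp: X_def)
    finally show ?case using Dia.IH by auto
  next
    case (Ex p)
    then have "ultra x" by (simp add: X_def)
    then have "sem B v (fm.Ex p) \<in> x \<longleftrightarrow> (\<exists>y. ultra y \<and> ?E x y \<and> sem B v p \<in> y)"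
      using E.crel_iff[OF _ sem_closed] v by simp
    also have "\<dots> \<longleftrightarrow> (\<exists>y\<in>X. ?E x y \<and> sem B v p \<in> y)"
      using up[OF Ex.prems] by (auto simp: X_def)
    finally show ?case using Ex.IH by auto
  qed (use v in \<open>auto simp: X_def V_def ultra_bot ultra_top ultra_neg ultra_meet ultra_join sem_closed\<close>)
  have x0X: "x0 \<in> X" using x0 Q.crel_refl by (simp add: X_def)
  show thesis by (rule that[OF frame nc x0X]) (use truth[OF x0X] x0(2) in auto)
qed

theorem theorem3p4:
  fixes n :: nat
  assumes "n \<ge> 1"
  shows "has_fmp TYPE('a) (MS4S n)"
  unfolding has_fmp_def
proof (intro allI impI)
  fix s t assume "\<exists>A :: 'a ms4. in_variety (MS4S n) A \<and> \<not> sat_eq A s t"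
  then obtain A :: "'a ms4" and v where A: "ms4_algebra A" "valid A (P0 1)" "valid A (P n)"
    and v: "\<And>i. v i \<in> carrier A" "sem A v s \<noteq> sem A v t"
    unfolding in_variety_def MS4S_def sat_eq_def by auto
  let ?R = "crel (dia A)" and ?E = "crel (ex A)"
  obtain X V x where X: "total_frame X ?R ?E" "\<And>x. x \<in> X \<Longrightarrow> \<not> chain X ?R n x" "x \<in> X"
    and x: "fsat X ?R ?E V x s \<noteq> fsat X ?R ?E V x t"
    using ms4_algebra.refuting_total_frame[OF A assms v] by metis
  have S: "finite (subfms s \<union> subfms t)" by (simp add: finite_subfms)
  obtain f R' E' V' where F: "finite_total_frame (f ` X) R' E'"
    and nc: "\<And>x. x \<in> X \<Longrightarrow> \<not> chain (f ` X) R' n (f x)"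
    and tr: "\<And>x p. \<lbrakk>x \<in> X; subfms p \<subseteq> subfms s \<union> subfms t\<rbrakk>
      \<Longrightarrow> fsat (f ` X) R' E' V' (f x) p \<longleftrightarrow> fsat X ?R ?E V x p"
    using total_frame.finite_quotient[OF X(1) assms X(2) S, of V] by (metis (no_types, lifting))
  interpret finite_total_frame "f ` X" R' E' by (rule F)
  let ?F = "cm (f ` X) R' E'" and ?v = "\<lambda>i. set_encode {w \<in> f ` X. w \<in> V' i}"
  have "finite (carrier ?F)" using fin by (simp add: cm_def)
  moreover have "in_variety (MS4S n) ?F" using cm_in_variety[OF assms] nc by blast
  moreover have "\<not> sat_eq ?F s t"
  proof
    assume "sat_eq ?F s t"
    moreover have "?v i \<in> carrier ?F" for i by (rule in_cm) auto
    ultimately have "sem ?F ?v s = sem ?F ?v t" unfolding sat_eq_def by (meson spec mp)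
    \<comment> \<open>Equal values are codes of equal truth sets, whereas the image of the refuting
      point lies in just one of the two.\<close>
    then have "{w \<in> f ` X. fsat (f ` X) R' E' V' w s} = {w \<in> f ` X. fsat (f ` X) R' E' V' w t}"
      unfolding sem_cm by (subst (asm) encode_eq) auto
    then have "fsat (f ` X) R' E' V' (f x) s \<longleftrightarrow> fsat (f ` X) R' E' V' (f x) t"
      using X(3) by blast
    then show False using x tr[OF X(3)] by auto
  qed
  ultimately show "\<exists>F :: nat ms4. finite (carrier F) \<and> in_variety (MS4S n) F \<and> \<not> sat_eq F s t"
    by blast
qed

end
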